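(* Let $k$ be a positive integer and let $G$ be a connected graph that is $(P_k,\text{claw},\text{butterfly},C_4,C_5)$-free. Then \[ c(G) \leq \Big\lceil \frac{k-1}{3}\Big\rceil+3. \]
   Context: Cops and Robbers is played on a connected graph: first the cop player places some number of cops on vertices, then the robber chooses a vertex; players alternate turns (cops first), and on a turn each cop (resp. the robber) moves to an adjacent vertex or stays put. The cops win if some cop eventually moves onto the robber's vertex. The cop number $c(G)$ is the least number of cops that guarantees a win for the cops regardless of the robber's play. A graph is $H$-free if it has no induced subgraph isomorphic to $H$, and $(H_1,\dots,H_m)$-free if it is $H_i$-free for every $i$. $P_t$ and $C_t$ denote the path and cycle on $t$ vertices. The claw is $K_{1,3}$. The butterfly is the 5-vertex graph obtained by identifying two triangles at one vertex. *)

theory Defs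
  imports Complex_Main "HOL-Library.Extended_Nat" "Graph_Theory.Graph_Theory"
begin

text \<open>
  Undirected simple graphs are loop-free symmetric pair digraphs
  (\<^locale>\<open>pair_bidirected_digraph\<close>), an edge being a pair of opposite arcs.
\<close>

definition induced_free :: "'b pair_pre_digraph \<Rightarrow> 'a pair_pre_digraph \<Rightarrow> bool" where
  "induced_free H G \<longleftrightarrow>
     \<not> (\<exists>S :: 'a pair_pre_digraph.
          induced_subgraph (with_proj S) (with_proj G) \<and>
          digraph_iso (with_proj S) (with_proj H))"

definition path_graph :: "nat \<Rightarrow> nat pair_pre_digraph" where
  "path_graph t =
     \<lparr> pverts = {..<t},
       parcs = {(i, j). i < t \<and> j < t \<and> (j = Suc i \<or> i = Suc j)} \<rparr>"

text \<open>Only meaningful for \<open>t \<ge> 3\<close>.\<close>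

definition cycle_graph :: "nat \<Rightarrow> nat pair_pre_digraph" where
  "cycle_graph t =
     \<lparr> pverts = {..<t},
       parcs = {(i, j). i < t \<and> j < t \<and> (j = Suc i mod t \<or> i = Suc j mod t)} \<rparr>"

definition claw :: "nat pair_pre_digraph" where
  "claw = \<lparr> pverts = {0, 1, 2, 3}, parcs = {0} \<times> {1, 2, 3} \<union> {1, 2, 3} \<times> {0} \<rparr>"

text \<open>The triangles \<open>0 1 2\<close> and \<open>0 3 4\<close> share the vertex \<open>0\<close>.\<close>

definition butterfly :: "nat pair_pre_digraph" where
  "butterfly =
     \<lparr> pverts = {0, 1, 2, 3, 4},
       parcs = {(u, v). u \<noteq> v \<and> ({u, v} \<subseteq> {0, 1, 2} \<or> {u, v} \<subseteq> {0, 3, 4})} \<rparr>"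

definition game_step :: "'a pair_pre_digraph \<Rightarrow> 'a \<Rightarrow> 'a \<Rightarrow> bool" where
  "game_step G u v \<longleftrightarrow> u \<in> pverts G \<and> (v = u \<or> (u, v) \<in> parcs G)"

text \<open>
  \<open>r 0\<close> is the vertex the robber chooses after the cops have been placed, and \<open>r t\<close> is his
  position after \<open>t\<close> moves.
\<close>

definition robber_play :: "'a pair_pre_digraph \<Rightarrow> (nat \<Rightarrow> 'a) \<Rightarrow> bool" where
  "robber_play G r \<longleftrightarrow> (\<forall>t. game_step G (r t) (r (Suc t)))"

text \<open>
  A cop strategy maps the list of robber positions seen so far to the current cop positions:
  \<open>s [] i\<close> is the initial vertex of cop \<open>i\<close>, and \<open>s [r 0, \<dots>, r t] i\<close> is the vertex to which cop \<open>i\<close>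
  moves in reply to \<open>r t\<close>. As the strategy determines the earlier cop positions, robber positions
  are a complete history of the game.
\<close>

type_synonym 'a cop_strategy = "'a list \<Rightarrow> nat \<Rightarrow> 'a"

definition cop_position :: "'a cop_strategy \<Rightarrow> (nat \<Rightarrow> 'a) \<Rightarrow> nat \<Rightarrow> nat \<Rightarrow> 'a" where
  "cop_position s r t = s (map r [0..<t])"

text \<open>
  Plays are continued indefinitely even after a capture, which is harmless because staying put is
  always allowed. A robber who moves onto a cop is captured when that cop stays put on its next turn.
\<close>

definition winning_cop_strategy :: "'a pair_pre_digraph \<Rightarrow> nat \<Rightarrow> 'a cop_strategy \<Rightarrow> bool" where
  "winning_cop_strategy G n s \<longleftrightarrow>
     (\<forall>r. robber_play G r \<longrightarrow>
        (\<forall>t. \<forall>i<n. game_step G (cop_position s r t i) (cop_position s r (Suc t) i)) \<and>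
        (\<exists>t. \<exists>i<n. cop_position s r (Suc t) i = r t))"

definition cops_win :: "'a pair_pre_digraph \<Rightarrow> nat \<Rightarrow> bool" where
  "cops_win G n \<longleftrightarrow> (\<exists>s. winning_cop_strategy G n s)"

text \<open>The value is \<open>\<infinity>\<close> if no finite number of cops suffices.\<close>

definition cop_number :: "'a pair_pre_digraph \<Rightarrow> enat" where
  "cop_number G = Inf (enat ` {n. cops_win G n})"

end

theory Submission
  imports Defs
begin

text \<open>
  The cops lay out an induced path \<open>p 0, \<dots>, p m\<close> that grows towards the robber's territory \<open>R\<close>, a
  connected set avoiding the closed neighbourhood of the path and whose boundary lies in that
  neighbourhood (Gyarfas' argument). Cop \<open>j\<close> walks to \<open>p (3 * j)\<close> and stays there. If the robber
  enters a boundary vertex \<open>z\<close> out of reach of the cops, then claw-freeness makes \<open>z\<close> adjacent to both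
  \<open>p (3 * j + 1)\<close> and \<open>p (3 * j + 2)\<close> for some \<open>j\<close>. Cops \<open>j\<close> and \<open>j + 1\<close> close in to these two vertices,
  and since a second neighbour of \<open>z\<close> away from them would give a claw or a butterfly, the robber can
  only go back to where he came from. So the path grows by one vertex at least every other round,
  and its length is bounded because there is no long induced path.
\<close>

section \<open>Induced copies from vertex embeddings\<close>

text \<open>The image of \<open>f\<close>, with the arcs of \<open>H\<close> carried along, is an
  induced subgraph because \<open>f\<close> preserves and reflects arcs; the inverse of
  \<open>f\<close> is an isomorphism onto \<open>H\<close>. So exhibiting a vertex map is enough to
  contradict freeness.\<close>

lemma induced_freeD:
  assumes free: "induced_free H G" and wfG: "pair_wf_digraph G" and wfH: "pair_wf_digraph H"
    and inj: "inj_on f (pverts H)" and sub: "f ` pverts H \<subseteq> pverts G"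
    and arcs: "\<And>u v. u \<in> pverts H \<Longrightarrow> v \<in> pverts H \<Longrightarrow> (f u, f v) \<in> parcs G \<longleftrightarrow> (u, v) \<in> parcs H"
  shows False
proof -
  define S where "S = \<lparr>pverts = f ` pverts H, parcs = map_prod f f ` parcs H\<rparr>"
  define g where "g = the_inv_into (pverts H) f"
  interpret G: pair_wf_digraph G by fact
  interpret H: pair_wf_digraph H by fact
  have g: "g (f u) = u" if "u \<in> pverts H" for u
    using that inj by (simp add: g_def the_inv_into_f_f)
  interpret S: pair_wf_digraph S
    by unfold_locales (auto simp: S_def dest: H.wellformed')
  have arcs_S: "parcs S = {e \<in> parcs G. fst e \<in> pverts S \<and> snd e \<in> pverts S}"
  proof (intro equalityI subsetI)
    fix e assume "e \<in> parcs S"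
    then show "e \<in> {e \<in> parcs G. fst e \<in> pverts S \<and> snd e \<in> pverts S}"
      using arcs H.wellformed' by (fastforce simp: S_def)
  next
    fix e assume "e \<in> {e \<in> parcs G. fst e \<in> pverts S \<and> snd e \<in> pverts S}"
    then obtain u v where "u \<in> pverts H" "v \<in> pverts H" "e = (f u, f v)" "(f u, f v) \<in> parcs G"
      by (cases e) (auto simp: S_def)
    then show "e \<in> parcs S" using arcs by (auto simp: S_def)
  qed
  have sub_S: "pverts S \<subseteq> pverts G" "parcs S \<subseteq> parcs G"
    using sub arcs_S by (auto simp: S_def)
  have "induced_subgraph (with_proj S) (with_proj G)"
    unfolding induced_subgraph_def subgraph_def compatible_def with_proj_simps
    by (intro conjI sub_S arcs_S refl S.wf_digraph_axioms G.wf_digraph_axioms)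
  moreover have "digraph_iso (with_proj S) (with_proj H)"
    unfolding digraph_iso_def
  proof (intro exI conjI)
    let ?i = "\<lparr>iso_verts = g, iso_arcs = map_prod g g, iso_head = snd, iso_tail = fst\<rparr>"
    have "inj_on g (pverts S)" by (auto simp: S_def g intro!: inj_onI)
    then show "pre_digraph.digraph_isomorphism (with_proj S) ?i"
      unfolding pre_digraph.digraph_isomorphism_def
      using S.wf_digraph_axioms S.wellformed'
      by (auto simp: inj_on_def)
    have "g ` pverts S = pverts H" by (auto simp: S_def g image_iff intro!: bexI)
    moreover have "map_prod g g ` parcs S = parcs H"
    proof -
      have "map_prod g g ` parcs S = (\<lambda>(u, v). (g (f u), g (f v))) ` parcs H"
        by (simp add: S_def image_image case_prod_unfold map_prod_def)
      also have "\<dots> = (\<lambda>e. e) ` parcs H"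
        by (rule image_cong) (auto simp: g dest: H.wellformed')
      finally show ?thesis by simp
    qed
    ultimately show "with_proj H = app_iso ?i (with_proj S)"
      by (simp add: app_iso_def with_proj_def)
  qed
  ultimately show False using free unfolding induced_free_def by blast
qed

section \<open>Winning positions and strategies\<close>

text \<open>\<open>c\<close> and \<open>r\<close> are the positions of the cops and the robber when it is the cops' turn.\<close>

fun win_within :: "'a pair_pre_digraph \<Rightarrow> nat \<Rightarrow> nat \<Rightarrow> (nat \<Rightarrow> 'a) \<Rightarrow> 'a \<Rightarrow> bool" where
  "win_within G N 0 c r \<longleftrightarrow> False"
| "win_within G N (Suc n) c r \<longleftrightarrow>
     (\<exists>c'. (\<forall>i<N. game_step G (c i) (c' i)) \<and>
        ((\<exists>i<N. c' i = r) \<or> (\<forall>r'. game_step G r r' \<longrightarrow> win_within G N n c' r')))"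

lemma win_within_mono: "win_within G N m c r \<Longrightarrow> m \<le> n \<Longrightarrow> win_within G N n c r"
proof (induction m arbitrary: n c r)
  case (Suc m)
  then obtain n' where n: "n = Suc n'" "m \<le> n'" by (cases n) auto
  obtain c' where c': "\<forall>i<N. game_step G (c i) (c' i)"
    "(\<exists>i<N. c' i = r) \<or> (\<forall>r'. game_step G r r' \<longrightarrow> win_within G N m c' r')"
    using Suc.prems(1) by auto
  show ?case unfolding n win_within.simps
    by (rule exI[of _ c']) (use c' Suc.IH[OF _ n(2)] in blast)
qed simp

lemma win_within_moveI:
  assumes "\<And>i. i < N \<Longrightarrow> game_step G (c i) (c' i)"
    and "\<And>r'. game_step G r r' \<Longrightarrow> win_within G N n c' r'"
  shows "win_within G N (Suc n) c r"
  using assms by auto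

text \<open>In a winning position some move captures at once or makes the least number of rounds
  still needed drop under every robber reply. This number cannot drop forever, so a strategy that
  always plays such moves wins.\<close>

lemma cops_winI:
  assumes win: "\<And>r. r \<in> pverts G \<Longrightarrow> \<exists>n. win_within G N n c0 r"
    and c0: "\<And>i. i < N \<Longrightarrow> c0 i \<in> pverts G" and wf: "pair_wf_digraph G"
  shows "cops_win G N"
proof -
  interpret pair_wf_digraph G by fact
  define rank where "rank c r = (LEAST n. win_within G N n c r)" for c r
  define good where "good c r c' \<longleftrightarrow> (\<forall>i<N. game_step G (c i) (c' i)) \<and>
     ((\<exists>n. win_within G N n c r) \<longrightarrow> (\<exists>i<N. c' i = r) \<or>
        (\<forall>r'. game_step G r r' \<longrightarrow> (\<exists>n. win_within G N n c' r') \<and> rank c' r' < rank c r))"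
    for c r c'
  define move where "move c r = (SOME c'. good c r c')" for c r
  have move: "good c r (move c r)" if c: "\<And>i. i < N \<Longrightarrow> c i \<in> pverts G" for c r
  proof -
    have "\<exists>c'. good c r c'"
    proof (cases "\<exists>n. win_within G N n c r")
      case False
      \<comment> \<open>Standing still is the default in positions that are not winning, so that
        \<open>move\<close> is legal in every position.\<close>
      then have "good c r c" using c by (simp add: good_def game_step_def)
      then show ?thesis by blast
    next
      case True
      then have "win_within G N (rank c r) c r" unfolding rank_def by (rule LeastI_ex)
      then obtain n where n: "rank c r = Suc n" "win_within G N (Suc n) c r"
        by (cases "rank c r") auto
      then obtain c' where c': "\<forall>i<N. game_step G (c i) (c' i)"
        "(\<exists>i<N. c' i = r) \<or> (\<forall>r'. game_step G r r' \<longrightarrow> win_within G N n c' r')" by auto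
      have "rank c' r' < rank c r" if "win_within G N n c' r'" for r'
        using Least_le[of "\<lambda>n. win_within G N n c' r'", OF that] n(1) by (simp add: rank_def)
      then have "good c r c'" using c' unfolding good_def by blast
      then show ?thesis by blast
    qed
    then show ?thesis unfolding move_def by (rule someI_ex)
  qed
  \<comment> \<open>A strategy sees only the robber's history; folding \<open>move\<close> over it
    recomputes where the cops stand.\<close>
  define s where "s h = foldl move c0 h" for h
  have "winning_cop_strategy G N s"
    unfolding winning_cop_strategy_def
  proof (intro allI impI)
    fix r assume r: "robber_play G r"
    then have step: "game_step G (r t) (r (Suc t))" for t by (simp add: robber_play_def)
    let ?c = "cop_position s r"
    have c_0: "?c 0 = c0" by (simp add: cop_position_def s_def)
    have c_Suc: "?c (Suc t) = move (?c t) (r t)" for t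
      by (simp add: cop_position_def s_def)
    have in_G: "i < N \<Longrightarrow> ?c t i \<in> pverts G" for t i
    proof (induction t arbitrary: i)
      case 0
      then show ?case by (simp add: c_0 c0)
    next
      case (Suc t)
      have "good (?c t) (r t) (?c (Suc t))" unfolding c_Suc by (rule move) (rule Suc.IH)
      then have "game_step G (?c t i) (?c (Suc t) i)" using Suc.prems by (simp add: good_def)
      then show ?case by (auto simp: game_step_def dest: wellformed')
    qed
    have good: "good (?c t) (r t) (?c (Suc t))" for t unfolding c_Suc by (rule move) (rule in_G)
    show "(\<forall>t. \<forall>i<N. game_step G (?c t i) (?c (Suc t) i)) \<and> (\<exists>t. \<exists>i<N. ?c (Suc t) i = r t)"
    proof (rule conjI)
      show "\<forall>t. \<forall>i<N. game_step G (?c t i) (?c (Suc t) i)" using good by (simp add: good_def)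
      show "\<exists>t. \<exists>i<N. ?c (Suc t) i = r t"
      proof (rule ccontr)
        assume free: "\<not> ?thesis"
        \<comment> \<open>Each round without capture lowers \<open>rank\<close> by at least one, so
          \<open>t\<close> cannot exceed the initial rank.\<close>
        have "(\<exists>n. win_within G N n (?c t) (r t)) \<and> rank (?c t) (r t) + t \<le> rank (?c 0) (r 0)" for t
        proof (induction t)
          case 0
          have "r 0 \<in> pverts G" using step[of 0] by (simp add: game_step_def)
          then show ?case using win by (simp add: c_0)
        next
          case (Suc t)
          then show ?case using good[of t] free step[of t] unfolding good_def by fastforce
        qed
        from this[of "Suc (rank (?c 0) (r 0))"] show False by simp
      qed
    qed
  qed
  then show ?thesis unfolding cops_win_def by blast
qed

section \<open>Connected vertex sets\<close>

text \<open>Connectedness is phrased by cuts, since what is needed later is an arc leaving a smaller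
  territory inside a larger one.\<close>

definition linked :: "'a rel \<Rightarrow> 'a set \<Rightarrow> bool" where
  "linked E S \<longleftrightarrow> (\<forall>A. A \<subseteq> S \<longrightarrow> A \<noteq> {} \<longrightarrow> A \<noteq> S \<longrightarrow> (\<exists>a\<in>A. \<exists>s\<in>S - A. (a, s) \<in> E))"

text \<open>If no arc led from \<open>A\<close> to the rest of the component, membership in
  \<open>A\<close> would be constant along walks from \<open>z\<close>; symmetry covers arcs
  entering \<open>A\<close>. Then \<open>A\<close> would be empty or the whole component.\<close>

lemma linked_component:
  assumes "sym E"
  shows "linked E {w. (z, w) \<in> rtrancl_on F E}" (is "linked E ?C")
  unfolding linked_def
proof (intro allI impI)
  fix A assume A: "A \<subseteq> ?C" "A \<noteq> {}" "A \<noteq> ?C"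
  show "\<exists>a\<in>A. \<exists>s\<in>?C - A. (a, s) \<in> E"
  proof (rule ccontr)
    assume none: "\<not> ?thesis"
    have "w \<in> A \<longleftrightarrow> z \<in> A" if "(z, w) \<in> rtrancl_on F E" for w
      using that
    proof (induction rule: rtrancl_on_induct)
      case (step u v)
      have "(z, v) \<in> rtrancl_on F E" using step by (blast intro: rtrancl_on_into_rtrancl_on)
      then show ?case using step none symD[OF assms step(2)] by blast
    qed simp
    then show False using A by blast
  qed
qed

section \<open>Claws and butterflies as local conditions\<close>

locale claw_butterfly_free_graph = pair_bidirected_digraph G for G :: "'a pair_pre_digraph" +
  assumes conn: "Digraph_Component.connected (with_proj G)"
    and claw_free: "induced_free claw G"
    and butterfly_free: "induced_free butterfly G"
begin

abbreviation adj :: "'a \<Rightarrow> 'a \<Rightarrow> bool" where "adj u v \<equiv> (u, v) \<in> parcs G"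
abbreviation near :: "'a \<Rightarrow> 'a \<Rightarrow> bool" where "near \<equiv> game_step G"

lemma adj_sym: "adj u v \<Longrightarrow> adj v u"
  using arcs_symmetric by blast

lemma not_adj_sym: "\<not> adj u v \<Longrightarrow> \<not> adj v u"
  using adj_sym by blast

lemma adj_irrefl: "\<not> adj u u"
  using pair_no_loops[of "(u, u)"] by auto

lemma near_iff: "u \<in> pverts G \<Longrightarrow> near u v \<longleftrightarrow> v = u \<or> adj u v"
  by (simp add: game_step_def)

lemma linked_verts: "linked (parcs G) (pverts G)"
proof -
  have sc: "strongly_connected (with_proj G)"
    using symmetric_connected_imp_strongly_connected[OF pair_sym_arcs conn] .
  show ?thesis
  unfolding linked_def
  proof (intro allI impI)
    fix A assume A: "A \<subseteq> pverts G" "A \<noteq> {}" "A \<noteq> pverts G"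
    then obtain a b where a: "a \<in> A" and b: "b \<in> pverts G" "b \<notin> A" by blast
    have "(a, b) \<in> rtrancl_on (pverts G) (parcs G)"
      using sc a b A(1) unfolding strongly_connected_def reachable_def by auto
    then have "b \<notin> A \<longrightarrow> (\<exists>a\<in>A. \<exists>s\<in>pverts G - A. (a, s) \<in> parcs G)"
      by (induction rule: rtrancl_on_induct) (use a in blast)+
    then show "\<exists>a\<in>A. \<exists>s\<in>pverts G - A. (a, s) \<in> parcs G" using b by blast
  qed
qed

lemma verts_nonempty: "pverts G \<noteq> {}"
  using conn unfolding connected_def strongly_connected_def by simp

lemma clawD:
  assumes "adj x a" "adj x b" "adj x c" "a \<noteq> b" "a \<noteq> c" "b \<noteq> c"
  shows "adj a b \<or> adj a c \<or> adj b c"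
proof (rule ccontr)
  assume none: "\<not> ?thesis"
  let ?f = "\<lambda>i. [x, a, b, c] ! i"
  have ne: "x \<noteq> a" "x \<noteq> b" "x \<noteq> c" using assms adj_irrefl by auto
  note rev = assms(1-3)[THEN adj_sym]
  have none': "\<not> adj a b" "\<not> adj a c" "\<not> adj b c" using none by auto
  show False
  proof (rule induced_freeD[OF claw_free, where f = ?f])
    show "pair_wf_digraph G" ..
    show "pair_wf_digraph claw" by unfold_locales (auto simp: claw_def)
    show "inj_on ?f (pverts claw)"
      using ne assms(4-6) by (auto simp: claw_def inj_on_def)
    show "?f ` pverts claw \<subseteq> pverts G" using assms(1-3) by (auto simp: claw_def dest: wellformed')
    show "adj (?f u) (?f v) \<longleftrightarrow> (u, v) \<in> parcs claw" if "u \<in> pverts claw" "v \<in> pverts claw" for u v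
      using that by (auto simp: claw_def assms(1-3) rev none' none'[THEN not_adj_sym] adj_irrefl)
  qed
qed

lemma butterflyD:
  assumes "adj x a" "adj x b" "adj x c" "adj x d" "adj a b" "adj c d"
    and "a \<noteq> c" "a \<noteq> d" "b \<noteq> c" "b \<noteq> d"
  shows "adj a c \<or> adj a d \<or> adj b c \<or> adj b d"
proof (rule ccontr)
  assume none: "\<not> ?thesis"
  let ?f = "\<lambda>i. [x, a, b, c, d] ! i"
  have ne: "x \<noteq> a" "x \<noteq> b" "x \<noteq> c" "x \<noteq> d" "a \<noteq> b" "c \<noteq> d" using assms adj_irrefl by auto
  note rev = assms(1-6)[THEN adj_sym]
  have none': "\<not> adj a c" "\<not> adj a d" "\<not> adj b c" "\<not> adj b d" using none by auto
  show False
  proof (rule induced_freeD[OF butterfly_free, where f = ?f])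
    show "pair_wf_digraph G" ..
    show "pair_wf_digraph butterfly" by unfold_locales (auto simp: butterfly_def)
    show "inj_on ?f (pverts butterfly)"
      using ne assms(7-10) by (auto simp: butterfly_def inj_on_def)
    show "?f ` pverts butterfly \<subseteq> pverts G"
      using assms(1-4) by (auto simp: butterfly_def dest: wellformed')
    show "adj (?f u) (?f v) \<longleftrightarrow> (u, v) \<in> parcs butterfly"
      if "u \<in> pverts butterfly" "v \<in> pverts butterfly" for u v
      using that
      by (auto simp: butterfly_def assms(1-6) rev none' none'[THEN not_adj_sym] adj_irrefl)
  qed
qed

section \<open>Induced paths\<close>

text \<open>Here \<open>n\<close> counts the vertices \<open>p 0, \<dots>, p (n - 1)\<close>.\<close>

definition ipath :: "nat \<Rightarrow> (nat \<Rightarrow> 'a) \<Rightarrow> bool" where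
  "ipath n p \<longleftrightarrow> inj_on p {..<n} \<and> p ` {..<n} \<subseteq> pverts G \<and>
     (\<forall>i<n. \<forall>j<n. adj (p i) (p j) \<longleftrightarrow> j = Suc i \<or> i = Suc j)"

lemma ipath_extend:
  assumes p: "ipath (Suc m) p" and b: "adj (p m) b"
    and nb: "\<And>i. i < m \<Longrightarrow> \<not> adj (p i) b" and new: "b \<notin> p ` {..m}"
  shows "ipath (Suc (Suc m)) (p(Suc m := b))"
proof -
  have "inj_on (p(Suc m := b)) {..<Suc (Suc m)}"
    using p new unfolding ipath_def inj_on_def
    by (auto simp: less_Suc_eq_le le_Suc_eq image_iff)
  moreover have "(p(Suc m := b)) ` {..<Suc (Suc m)} \<subseteq> pverts G"
    using p b unfolding ipath_def by (auto simp: less_Suc_eq dest: wellformed')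
  moreover have "adj ((p(Suc m := b)) i) ((p(Suc m := b)) j) \<longleftrightarrow> j = Suc i \<or> i = Suc j"
    if "i < Suc (Suc m)" "j < Suc (Suc m)" for i j
  proof -
    have *: "adj (p i) b \<longleftrightarrow> i = m" if "i \<le> m" for i
      using that b nb by (cases "i = m") auto
    have **: "adj b (p i) \<longleftrightarrow> i = m" if "i \<le> m" for i
      using *[OF that] adj_sym by blast
    show ?thesis using that p adj_irrefl[of b] * ** unfolding ipath_def
      by (cases "i = Suc m"; cases "j = Suc m") auto
  qed
  ultimately show ?thesis unfolding ipath_def by blast
qed

lemma ipath_less:
  assumes free: "induced_free (path_graph k) G" and p: "ipath n p"
  shows "n < k"
proof (rule ccontr)
  assume "\<not> n < k"
  then have kn: "k \<le> n" by simp
  show False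
  proof (rule induced_freeD[OF free, where f = p])
    show "pair_wf_digraph G" ..
    show "pair_wf_digraph (path_graph k)" by unfold_locales (auto simp: path_graph_def)
    show "inj_on p (pverts (path_graph k))"
      using p kn unfolding ipath_def by (auto simp: path_graph_def intro: inj_on_subset)
    show "p ` pverts (path_graph k) \<subseteq> pverts G"
      using p kn unfolding ipath_def by (auto simp: path_graph_def)
    show "adj (p u) (p v) \<longleftrightarrow> (u, v) \<in> parcs (path_graph k)"
      if "u \<in> pverts (path_graph k)" "v \<in> pverts (path_graph k)" for u v
      using that p kn unfolding ipath_def by (auto simp: path_graph_def)
  qed
qed

section \<open>The robber's territory\<close>

text \<open>The last conjunct provides the vertex by which the path is extended next.\<close>

definition confined :: "nat \<Rightarrow> (nat \<Rightarrow> 'a) \<Rightarrow> 'a set \<Rightarrow> bool" where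
  "confined m p R \<longleftrightarrow> ipath (Suc m) p \<and> R \<subseteq> pverts G \<and> linked (parcs G) R \<and>
     (\<forall>i\<le>m. \<forall>u\<in>R. \<not> near (p i) u) \<and>
     (\<forall>u\<in>R. \<forall>w. adj u w \<longrightarrow> w \<notin> R \<longrightarrow> (\<exists>i\<le>m. adj (p i) w)) \<and>
     (\<exists>b. adj (p m) b \<and> (\<exists>u\<in>R. adj b u) \<and> (\<forall>i<m. \<not> adj (p i) b))"

text \<open>The new territory is the component of \<open>z\<close> in \<open>S\<close> after
  deleting the closed neighbourhood of the tip \<open>p m\<close>. As \<open>S\<close> is linked and
  meets that neighbourhood, an arc leads from the component to some \<open>b\<close> in
  \<open>S\<close>. This \<open>b\<close> is adjacent to the tip but to no earlier path vertex, so
  it can extend the path.\<close>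

lemma confined_component:
  assumes S: "S \<subseteq> pverts G" "linked (parcs G) S" and z: "z \<in> S" "\<not> near (p m) z"
    and meet: "v \<in> S" "near (p m) v" and p: "ipath (Suc m) p"
    and away: "\<And>i u. i < m \<Longrightarrow> u \<in> S \<Longrightarrow> \<not> near (p i) u"
    and bd: "\<And>u w. u \<in> S \<Longrightarrow> adj u w \<Longrightarrow> w \<notin> S \<Longrightarrow> \<exists>i\<le>m. adj (p i) w"
  shows "\<exists>R. z \<in> R \<and> confined m p R"
proof -
  define F where "F = {u \<in> S. \<not> near (p m) u}"
  define R where "R = {w. (z, w) \<in> rtrancl_on F (parcs G)}"
  have pm: "p m \<in> pverts G" using p unfolding ipath_def by auto
  have RF: "R \<subseteq> F" unfolding R_def by (auto dest: in_rtrancl_on_in_F)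
  have zR: "z \<in> R" using z unfolding R_def F_def by auto
  have leave: "near (p m) w" if "u \<in> R" "adj u w" "w \<in> S" "w \<notin> R" for u w
    using that unfolding R_def F_def by (auto intro: rtrancl_on_into_rtrancl_on)
  have leave': "adj (p m) w" if "u \<in> R" "adj u w" "w \<in> S" "w \<notin> R" for u w
  proof -
    have "w \<noteq> p m"
      using that(1,2) RF adj_sym pm by (auto simp: F_def near_iff)
    then show ?thesis using leave[OF that] pm by (auto simp: near_iff)
  qed
  have "R \<noteq> S" using meet RF unfolding F_def by auto
  moreover have "R \<subseteq> S" using RF unfolding F_def by auto
  ultimately obtain u b where ub: "u \<in> R" "b \<in> S" "b \<notin> R" "adj u b"
    using S(2) zR unfolding linked_def by blast
  have "\<forall>i<m. \<not> adj (p i) b"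
    using away[OF _ ub(2)] by (auto simp: game_step_def dest: wellformed')
  moreover have "linked (parcs G) R"
    unfolding R_def by (rule linked_component) (auto intro: symI adj_sym)
  moreover have "\<exists>i\<le>m. adj (p i) w" if "u \<in> R" "adj u w" "w \<notin> R" for u w
    using leave'[OF that(1,2) _ that(3)] bd[of u w] that RF unfolding F_def by auto
  moreover have "\<not> near (p i) u" if "i \<le> m" "u \<in> R" for i u
    using that RF away[of i u] unfolding F_def by (cases "i = m") auto
  ultimately have "confined m p R"
    unfolding confined_def using p S(1) \<open>R \<subseteq> S\<close> leave'[OF ub(1,4,2,3)] ub(1) adj_sym[OF ub(4)]
    by blast
  then show ?thesis using zR by blast
qed

section \<open>The strategy of the cops\<close>

text \<open>
  A cop responsible for \<open>p (3 * j)\<close> may be one step away from it, having just driven the robber back.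
\<close>

definition ready :: "nat \<Rightarrow> nat \<Rightarrow> (nat \<Rightarrow> 'a) \<Rightarrow> (nat \<Rightarrow> 'a) \<Rightarrow> bool" where
  "ready N m p c \<longleftrightarrow> (\<forall>j<N. if 3 * j \<le> m then near (c j) (p (3 * j)) else c j = p m)"

lemma win_within_near:
  assumes "j < N" "near (c j) r" and c: "\<And>i. i < N \<Longrightarrow> c i \<in> pverts G"
  shows "win_within G N (Suc n) c r"
  using assms by (auto intro!: exI[of _ "c(j := r)"] simp: near_iff)

text \<open>Each new path vertex costs at most two rounds, and freeness keeps the path shorter than
  \<open>k\<close>, whence the budget \<open>2 * (k - m)\<close>. The bound on \<open>N\<close>
  provides a cop for every third path vertex and one more that always travels with the tip.\<close>

lemma win_within_confined:
  assumes free: "induced_free (path_graph k) G" and N: "k + 3 \<le> 3 * N"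
  shows "confined m p R \<Longrightarrow> y \<in> R \<Longrightarrow> ready N m p c \<Longrightarrow> win_within G N (2 * (k - m)) c y"
proof (induction "k - m" arbitrary: m p R y c rule: less_induct)
  case less
  have p: "ipath (Suc m) p" and RV: "R \<subseteq> pverts G" and Rl: "linked (parcs G) R"
    and away: "\<And>i u. i \<le> m \<Longrightarrow> u \<in> R \<Longrightarrow> \<not> near (p i) u"
    and bd: "\<And>u w. u \<in> R \<Longrightarrow> adj u w \<Longrightarrow> w \<notin> R \<Longrightarrow> \<exists>i\<le>m. adj (p i) w"
    using less.prems(1) unfolding confined_def by blast+
  obtain b u where b: "adj (p m) b" "adj b u" "\<And>i. i < m \<Longrightarrow> \<not> adj (p i) b" and u: "u \<in> R"
    using less.prems(1) unfolding confined_def by blast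
  have pV: "p i \<in> pverts G" if "i \<le> m" for i using p that unfolding ipath_def by auto
  have away_adj: "\<not> adj (p i) v" "\<not> adj v (p i)" if "i \<le> m" "v \<in> R" for i v
    using away[OF that] pV[OF that(1)] adj_sym[of v "p i"] by (auto simp: near_iff)
  define m' where "m' = Suc m"
  define p' where "p' = p(m' := b)"
  have p'_m': "p' m' = b" and p'_eq: "\<And>i. i \<le> m \<Longrightarrow> p' i = p i" by (auto simp: p'_def m'_def)
  have bV: "b \<in> pverts G" using b(1) wellformed' by blast
  have bR: "b \<notin> R" using away_adj[of m b] b(1) by blast
  have "b \<notin> p ` {..m}" using away_adj(1)[OF _ u] b(2) by auto
  then have p': "ipath (Suc m') p'"
    unfolding p'_def m'_def using p b by (intro ipath_extend) auto
  \<comment> \<open>Appending \<open>u\<close> as well as \<open>b\<close> gives a longer induced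
    path, so rounds remain in the budget after the extension.\<close>
  have "ipath (Suc (Suc m')) (p'(Suc m' := u))"
  proof (rule ipath_extend[OF p'])
    show "adj (p' m') u" using b(2) by (simp add: p'_m')
    show "\<not> adj (p' i) u" if "i < m'" for i
      using that away_adj(1)[OF _ u] by (simp add: m'_def p'_eq)
    show "u \<notin> p' ` {..m'}"
      using u bR away[OF _ u] near_iff[OF pV]
      by (auto simp: m'_def atMost_Suc p'_m'[unfolded m'_def] p'_eq)
  qed
  then have mk: "m' + 2 < k" using ipath_less[OF free] by fastforce
  have p'V: "p' i \<in> pverts G" if "i \<le> m'" for i using p' that unfolding ipath_def by auto
  have p'_adj: "adj (p' i) (p' j) \<longleftrightarrow> j = Suc i \<or> i = Suc j" if "i \<le> m'" "j \<le> m'" for i j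
    using p' that unfolding ipath_def by auto
  have p'_inj: "p' i = p' j \<longleftrightarrow> i = j" if "i \<le> m'" "j \<le> m'" for i j
    using p' that unfolding ipath_def inj_on_def by auto
  have p'_near: "near (p' i) (p' j) \<longleftrightarrow> j = i \<or> j = Suc i \<or> i = Suc j"
    if "i \<le> m'" "j \<le> m'" for i j
    using that by (auto simp: near_iff p'V p'_adj p'_inj)
  \<comment> \<open>The minimum keeps cops without a post of their own together at the tip, which
    has just moved to \<open>b\<close>.\<close>
  define c' where "c' j = p' (min (3 * j) m')" for j
  have c'V: "c' i \<in> pverts G" for i by (simp add: c'_def p'V)
  have c_c': "near (c i) (c' i)" if "i < N" for i
  proof (cases "3 * i \<le> m")
    case True
    then show ?thesis using less.prems(3) that by (simp add: ready_def c'_def p'_eq m'_def)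
  next
    case False
    then have "c i = p m" "c' i = b" using less.prems(3) that
      by (simp_all add: ready_def c'_def m'_def flip: p'_m')
    then show ?thesis using b(1) pV by (simp add: near_iff)
  qed
  have last: "N - 1 < N" "m' < 3 * (N - 1)" using N mk by auto
  have c'_last: "c' (N - 1) = b" using last by (simp add: c'_def p'_m')
  \<comment> \<open>With the robber still in \<open>R\<close> and the path extended, either the cop
    at \<open>b\<close> captures him or the territory shrinks to a component and the induction
    hypothesis applies.\<close>
  have continue: "win_within G N (2 * (k - m')) c'' w"
    if "w \<in> R" and c'': "ready N m' p' c''" "\<And>i. i < N \<Longrightarrow> c'' i \<in> pverts G" for w c''
  proof (cases "near b w")
    case True
    have "c'' (N - 1) = b" using c''(1) last by (auto simp: ready_def p'_m')
    moreover obtain n where "2 * (k - m') = Suc n" using mk by (cases "2 * (k - m')") auto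
    ultimately show ?thesis
      using win_within_near[of "N - 1" N c'' w n] c''(2) last True by simp
  next
    case False
    have "\<exists>R'. w \<in> R' \<and> confined m' p' R'"
    proof (rule confined_component[OF RV Rl \<open>w \<in> R\<close> _ u _ p'])
      show "\<not> near (p' m') w" using False by (simp add: p'_m')
      show "near (p' m') u" using b(2) bV by (simp add: p'_m' near_iff)
      show "\<not> near (p' i) v" if "i < m'" "v \<in> R" for i v
        using that away by (simp add: m'_def p'_eq)
      show "\<exists>i\<le>m'. adj (p' i) w" if "v \<in> R" "adj v w" "w \<notin> R" for v w
        using bd[OF that] p'_eq unfolding m'_def by (metis le_SucI)
    qed
    then obtain R' where "w \<in> R'" "confined m' p' R'" by blast
    then show ?thesis using less.hyps[of m' p' R' w c''] mk c''(1) by (simp add: m'_def)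
  qed
  have reply: "win_within G N (Suc (2 * (k - m'))) c' z" if yz: "near y z" for z
  proof (cases "z \<in> R")
    case True
    have "ready N m' p' c'"
      unfolding ready_def by (simp add: c'_def p'_near)
    then have "win_within G N (2 * (k - m')) c' z" using continue True c'V by blast
    then show ?thesis by (rule win_within_mono) simp
  next
    case False
    show ?thesis
    proof (cases "\<exists>j<N. near (c' j) z")
      case True
      then show ?thesis using win_within_near c'V by blast
    next
      case no_cop: False
      have yR: "y \<in> R" by fact
      have "adj y z" using yz False yR by (auto simp: game_step_def)
      then obtain i where i: "i \<le> m" "adj (p i) z" using bd[OF yR _ False] by blast
      have z_ne: "z \<noteq> p' l" if "l \<le> m'" for l
      proof (cases "l = m'")
        case True
        then show ?thesis using no_cop last(1) c'_last bV p'_m' by (auto simp: near_iff)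
      next
        case False
        then show ?thesis
          using that away_adj(2)[OF _ yR] \<open>adj y z\<close> by (auto simp: m'_def p'_eq)
      qed
      \<comment> \<open>Vertices with index divisible by 3 are occupied, so none of them is adjacent
        to the unreachable \<open>z\<close>; the same holds for the tip.\<close>
      have post: "\<not> adj (p' (3 * j)) z" if "3 * j \<le> m'" for j
      proof -
        have "j < N" "c' j = p' (3 * j)" using that last by (auto simp: c'_def)
        then show ?thesis using no_cop p'V[OF that] by (auto simp: near_iff)
      qed
      have front: "\<not> adj (p' m') z"
        using no_cop last(1) c'_last bV p'_m' by (auto simp: near_iff)
      have claw': "adj (p' l) z \<or> adj (p' (Suc (Suc l))) z"
        if "Suc (Suc l) \<le> m'" "adj (p' (Suc l)) z" for l
      proof -
        have "adj (p' (Suc l)) (p' l)" "adj (p' (Suc l)) (p' (Suc (Suc l)))"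
          "\<not> adj (p' l) (p' (Suc (Suc l)))" "p' l \<noteq> p' (Suc (Suc l))"
          using that(1) by (simp_all add: p'_adj p'_inj)
        then show ?thesis
          using clawD[of "p' (Suc l)" "p' l" "p' (Suc (Suc l))" z] that z_ne[of l]
            z_ne[of "Suc (Suc l)"] by auto
      qed
      have i': "adj (p' i) z" using i by (simp add: p'_eq)
      \<comment> \<open>A neighbour of \<open>z\<close> on the path has index 1 or 2 modulo 3. The
        claw centred there forces a second neighbour beside it, which must be the other of the two.
        The tip is not adjacent to \<open>z\<close>, so the post \<open>3 * j + 3\<close>
        exists.\<close>
      define j where "j = i div 3"
      have "i mod 3 = 0 \<or> i mod 3 = 1 \<or> i mod 3 = 2" by arith
      then have "i = 3 * j \<or> i = 3 * j + 1 \<or> i = 3 * j + 2" unfolding j_def by presburger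
      then have j: "3 * j + 3 \<le> m' \<and> adj (p' (3 * j + 1)) z \<and> adj (p' (3 * j + 2)) z"
      proof (elim disjE)
        assume "i = 3 * j"
        then show ?thesis using post[of j] i' i(1) by (simp add: m'_def)
      next
        assume ij: "i = 3 * j + 1"
        then have "adj (p' (3 * j + 2)) z"
          using claw'[of "3 * j"] post[of j] i' i(1) by (simp add: m'_def)
        moreover from this have "3 * j + 2 \<noteq> m'" using front by metis
        ultimately show ?thesis using ij i' i(1) by (simp add: m'_def)
      next
        assume ij: "i = 3 * j + 2"
        then show ?thesis
          using claw'[of "3 * j + 1"] post[of "Suc j"] i' i(1)
          by (simp add: m'_def numeral_3_eq_3 numeral_2_eq_2)
      qed
      let ?a = "p' (3 * j + 1)" and ?b = "p' (3 * j + 2)"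
      have jN: "j < N" "Suc j < N" "j \<noteq> N - 1" "Suc j \<noteq> N - 1" using j last by auto
      have ab: "adj ?a ?b" using j by (simp add: p'_adj)
      have ya: "\<not> adj ?a y" "\<not> adj ?b y" "y \<noteq> ?a" "y \<noteq> ?b"
        using j away_adj[OF _ yR] away[OF _ yR] pV by (auto simp: m'_def p'_eq near_iff)
      \<comment> \<open>Cop \<open>j\<close> steps forward and cop \<open>Suc j\<close> steps back,
        each staying within one step of its post as \<open>ready\<close> permits.\<close>
      define c'' where "c'' = c'(j := ?a, Suc j := ?b)"
      have c''V: "c'' i \<in> pverts G" for i using c'V p'V j by (simp add: c''_def)
      have c'_c'': "near (c' l) (c'' l)" for l
        using j by (simp add: c''_def c'_def p'_near)
      have c''_ready: "ready N m' p' c''"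
        unfolding ready_def
        using j by (simp add: c''_def c'_def p'_near)
      have "win_within G N (2 * (k - m')) c'' w" if zw: "near z w" for w
      proof (cases "near ?a w \<or> near ?b w")
        case True
        obtain n where n: "2 * (k - m') = Suc n" using mk by (cases "2 * (k - m')") auto
        have "near (c'' j) w \<or> near (c'' (Suc j)) w" using True by (simp add: c''_def)
        then show ?thesis unfolding n using jN c''V win_within_near by blast
      next
        case False
        have aV: "?a \<in> pverts G" "?b \<in> pverts G" using j p'V by auto
        have w: "\<not> adj ?a w" "\<not> adj ?b w" "w \<noteq> ?a" "w \<noteq> ?b"
          using False aV by (auto simp: near_iff)
        \<comment> \<open>Both \<open>w\<close> and \<open>y\<close> are neighbours of
          \<open>z\<close> not adjacent to \<open>?a\<close> or \<open>?b\<close>. If they were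
          distinct, then at \<open>z\<close> they would form a butterfly with the triangle through
          \<open>?a\<close> and \<open>?b\<close> when adjacent, and a claw with \<open>?a\<close>
          otherwise.\<close>
        have "w = y"
        proof (rule ccontr)
          assume "w \<noteq> y"
          have "w \<noteq> z" using w j by auto
          then have zw': "adj z w" using zw by (auto simp: game_step_def)
          have z: "adj z ?a" "adj z ?b" "adj z y" using j \<open>adj y z\<close> adj_sym by blast+
          show False
          proof (cases "adj w y")
            case True
            then show False using butterflyD[OF z(1,2) zw' z(3) ab] w ya by auto
          next
            case False
            then show False using clawD[OF z(1) zw' z(3)] w ya \<open>w \<noteq> y\<close> by auto
          qed
        qed
        then show ?thesis using continue yR c''_ready c''V by blast
      qed
      then show ?thesis using c'_c'' by (intro win_within_moveI)
    qed
  qed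
  have "2 * (k - m) = Suc (Suc (2 * (k - m')))" using mk by (simp add: m'_def)
  moreover have "win_within G N (Suc (Suc (2 * (k - m')))) c y"
    by (rule win_within_moveI) (fact c_c' reply)+
  ultimately show ?case by (simp only:)
qed

section \<open>Opening position and final bound\<close>

text \<open>All cops start at one vertex \<open>v\<close>, which serves as a one-vertex path. A
  robber out of reach is confined to his component outside the closed neighbourhood of
  \<open>v\<close>.\<close>

lemma cops_win_path_free:
  assumes free: "induced_free (path_graph k) G" and N: "k + 3 \<le> 3 * N"
  shows "cops_win G N"
proof -
  obtain v where v: "v \<in> pverts G" using verts_nonempty by blast
  show ?thesis
  proof (rule cops_winI)
    show "pair_wf_digraph G" ..
    show "(\<lambda>_. v) i \<in> pverts G" if "i < N" for i using v .
    show "\<exists>n. win_within G N n (\<lambda>_. v) r" if r: "r \<in> pverts G" for r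
    proof (cases "near v r")
      case True
      have "0 < N" using N by simp
      then show ?thesis using win_within_near[of 0 N "\<lambda>_. v" r] v True by blast
    next
      case False
      have p: "ipath (Suc 0) (\<lambda>_. v)" using v by (auto simp: ipath_def inj_on_def adj_irrefl)
      have "\<exists>R. r \<in> R \<and> confined 0 (\<lambda>_. v) R"
        by (rule confined_component[OF subset_refl linked_verts r _ v _ p])
          (use False v wellformed' in \<open>auto simp: near_iff\<close>)
      moreover have "ready N 0 (\<lambda>_. v) (\<lambda>_. v)" using v by (simp add: ready_def near_iff)
      ultimately show ?thesis using win_within_confined[OF free N] by blast
    qed
  qed
qed

end

theorem theorem1p2:
  fixes G :: "'a pair_pre_digraph" and k :: nat
  assumes "k \<ge> 1"
    and "pair_bidirected_digraph G"
    and "Digraph_Component.connected (with_proj G)"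
    and "induced_free (path_graph k) G"
    and "induced_free claw G"
    and "induced_free butterfly G"
    and "induced_free (cycle_graph 4) G"
    and "induced_free (cycle_graph 5) G"
  shows "cop_number G \<le> enat (nat \<lceil>(real k - 1) / 3\<rceil> + 3)"
proof -
  interpret pair_bidirected_digraph G by fact
  interpret claw_butterfly_free_graph G using assms by unfold_locales
  define n where "n = nat \<lceil>(real k - 1) / 3\<rceil>"
  \<comment> \<open>This gives \<open>k \<le> 3 * n + 1\<close>, from which the required bound on
    \<open>n + 3\<close> cops follows.\<close>
  have "(real k - 1) / 3 \<le> real n" unfolding n_def by linarith
  then have "real (k + 3) \<le> real (3 * (n + 3))" by simp
  then have "k + 3 \<le> 3 * (n + 3)" unfolding of_nat_le_iff .
  then have "cops_win G (n + 3)" using assms(4) by (intro cops_win_path_free)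
  then show ?thesis unfolding cop_number_def n_def by (auto intro: Inf_lower)
qed

end
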